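(* Let $X$ be a compact Hausdorff space, $\Delta_1\subset X$ clopen, $\alpha:\Delta_1\to X$ continuous, $\Delta_{-1}=\alpha(\Delta_1)$, and let $\widetilde X$ be the $\alpha$-extension of $X$ with $\Phi:\widetilde X\to X$, $\Phi(x_0,x_1,\dots)=x_0$, $\widetilde\Delta_1=\Phi^{-1}(\Delta_1)$, $\widetilde\Delta_{-1}=\Phi^{-1}(\Delta_{-1})$. Then the mapping $\widetilde\alpha:\widetilde\Delta_1\to\widetilde\Delta_{-1}$ given by $$\widetilde\alpha(\widetilde x)=(\alpha(x_0),x_0,x_1,\dots),\qquad\widetilde x=(x_0,x_1,\dots)\in\widetilde\Delta_1,$$ is a homeomorphism (and hence, if $\Delta_{-1}$ is open, $\widetilde\alpha$ is a partial homeomorphism of $\widetilde X$) such that $\Phi\circ\widetilde\alpha=\alpha\circ\Phi$ on $\widetilde\Delta_1$.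
   Context: For $n\ge1$, $\Delta_n$ is the domain of $\alpha^n$; $\Delta_0=X$. A partial mapping of a space is a continuous map from a clopen subset into the space; a partial homeomorphism is a partial mapping which is injective and has open image. $\alpha$-extension: adjoin to $X$ an isolated point, denoted $0$. $\widetilde X=\bigcup_{N\ge0}X_N\cup X_\infty\subset\prod_{n=0}^\infty(X\cup\{0\})$ with the topology induced from the product topology, where $X_N=\{(x_0,\dots,x_N,0,0,\dots):x_n\in\Delta_n,\ x_N\notin\Delta_{-1},\ \alpha(x_n)=x_{n-1}\text{ for }1\le n\le N\}$ and $X_\infty=\{(x_0,x_1,\dots):x_n\in\Delta_n,\ \alpha(x_n)=x_{n-1}\text{ for }n\ge1\}$. *)

theory Defs
  imports "HOL-Analysis.Analysis"
begin

text \<open>A partial map with domain \<open>D\<close> is given by a total function together with \<open>D\<close>;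
  the values of the function outside \<open>D\<close> are irrelevant.\<close>

definition partial_mapping :: "'a topology \<Rightarrow> 'a set \<Rightarrow> ('a \<Rightarrow> 'a) \<Rightarrow> bool" where
  "partial_mapping X D f \<longleftrightarrow>
     openin X D \<and> closedin X D \<and> continuous_map (subtopology X D) X f"

definition partial_homeomorphism :: "'a topology \<Rightarrow> 'a set \<Rightarrow> ('a \<Rightarrow> 'a) \<Rightarrow> bool" where
  "partial_homeomorphism X D f \<longleftrightarrow>
     partial_mapping X D f \<and> inj_on f D \<and> openin X (f ` D)"

text \<open>The domain of the \<open>n\<close>-th iterate of the partial map \<open>f\<close> with domain \<open>D\<close>, iterates being
  formed by composition of partial maps.\<close>

primrec iterate_domain :: "'a topology \<Rightarrow> 'a set \<Rightarrow> ('a \<Rightarrow> 'a) \<Rightarrow> nat \<Rightarrow> 'a set" where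
  "iterate_domain X D f 0 = topspace X"
| "iterate_domain X D f (Suc n) = {x \<in> iterate_domain X D f n. (f ^^ n) x \<in> D}"

text \<open>The space \<open>X\<close> with an isolated point adjoined: \<^term>\<open>None\<close> is the new point \<open>0\<close>
  and \<^term>\<open>Some\<close> embeds \<open>X\<close> as an open subspace.\<close>

definition adjoin_isolated :: "'a topology \<Rightarrow> 'a option topology" where
  "adjoin_isolated X =
     topology (\<lambda>U. U \<subseteq> insert None (Some ` topspace X) \<and> openin X {x. Some x \<in> U})"

lemma openin_adjoin_isolated:
  "openin (adjoin_isolated X) U \<longleftrightarrow>
     U \<subseteq> insert None (Some ` topspace X) \<and> openin X {x. Some x \<in> U}"
proof -
  have "istopology (\<lambda>U. U \<subseteq> insert None (Some ` topspace X) \<and> openin X {x. Some x \<in> U})"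
    unfolding istopology_def
  proof (intro conjI allI impI)
    fix S T :: "'a option set"
    assume S: "S \<subseteq> insert None (Some ` topspace X) \<and> openin X {x. Some x \<in> S}"
      and T: "T \<subseteq> insert None (Some ` topspace X) \<and> openin X {x. Some x \<in> T}"
    show "S \<inter> T \<subseteq> insert None (Some ` topspace X)" using S by blast
    have "{x. Some x \<in> S \<inter> T} = {x. Some x \<in> S} \<inter> {x. Some x \<in> T}" by blast
    then show "openin X {x. Some x \<in> S \<inter> T}" using S T by (simp add: openin_Int)
  next
    fix \<K> :: "'a option set set"
    assume K: "\<forall>K\<in>\<K>. K \<subseteq> insert None (Some ` topspace X) \<and> openin X {x. Some x \<in> K}"
    show "\<Union>\<K> \<subseteq> insert None (Some ` topspace X)" using K by blast
    have "{x. Some x \<in> \<Union>\<K>} = (\<Union>K\<in>\<K>. {x. Some x \<in> K})" by blast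
    then show "openin X {x. Some x \<in> \<Union>\<K>}" using K by (simp add: openin_clauses(3))
  qed
  then show ?thesis
    by (simp add: adjoin_isolated_def)
qed

lemma topspace_adjoin_isolated:
  "topspace (adjoin_isolated X) = insert None (Some ` topspace X)"
proof -
  have "{x. Some x \<in> insert None (Some ` topspace X)} = topspace X" by blast
  then have "openin (adjoin_isolated X) (insert None (Some ` topspace X))"
    by (simp add: openin_adjoin_isolated)
  then show ?thesis
    by (metis openin_adjoin_isolated openin_subset openin_topspace subset_antisym)
qed

definition ext_finite :: "'a topology \<Rightarrow> 'a set \<Rightarrow> ('a \<Rightarrow> 'a) \<Rightarrow> nat \<Rightarrow> (nat \<Rightarrow> 'a option) set" where
  "ext_finite X D f N =
     {(\<lambda>n. if n \<le> N then Some (x n) else None) | x.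
        (\<forall>n\<le>N. x n \<in> iterate_domain X D f n) \<and> x N \<notin> f ` D \<and>
        (\<forall>n. 1 \<le> n \<and> n \<le> N \<longrightarrow> f (x n) = x (n - 1))}"

definition ext_infinite :: "'a topology \<Rightarrow> 'a set \<Rightarrow> ('a \<Rightarrow> 'a) \<Rightarrow> (nat \<Rightarrow> 'a option) set" where
  "ext_infinite X D f =
     {(\<lambda>n. Some (x n)) | x.
        (\<forall>n. x n \<in> iterate_domain X D f n) \<and> (\<forall>n\<ge>1. f (x n) = x (n - 1))}"

definition extension :: "'a topology \<Rightarrow> 'a set \<Rightarrow> ('a \<Rightarrow> 'a) \<Rightarrow> (nat \<Rightarrow> 'a option) topology" where
  "extension X D f =
     subtopology (product_topology (\<lambda>_. adjoin_isolated X) UNIV)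
       ((\<Union>N. ext_finite X D f N) \<union> ext_infinite X D f)"

text \<open>On the extension the zeroth coordinate always has the form \<^term>\<open>Some x\<close>, so that
  \<^const>\<open>the\<close> only identifies \<open>X\<close> with its copy in \<^term>\<open>adjoin_isolated X\<close>.\<close>

definition ext_proj :: "(nat \<Rightarrow> 'a option) \<Rightarrow> 'a" where
  "ext_proj x = the (x 0)"

definition ext_preimage ::
    "'a topology \<Rightarrow> 'a set \<Rightarrow> ('a \<Rightarrow> 'a) \<Rightarrow> 'a set \<Rightarrow> (nat \<Rightarrow> 'a option) set" where
  "ext_preimage X D f A = {x \<in> topspace (extension X D f). ext_proj x \<in> A}"

definition ext_map :: "('a \<Rightarrow> 'a) \<Rightarrow> (nat \<Rightarrow> 'a option) \<Rightarrow> (nat \<Rightarrow> 'a option)" where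
  "ext_map f x = (\<lambda>n. case n of 0 \<Rightarrow> Some (f (ext_proj x)) | Suc m \<Rightarrow> x m)"

end

theory Submission
  imports Defs
begin

text \<open>Membership in the extension is a condition on consecutive coordinates only, and the same
  condition at every index. Hence the left shift inverts \<^const>\<open>ext_map\<close> and both maps are
  continuous because their coordinates are. The preimage of the image of \<open>\<Delta>1\<close> consists of the
  sequences that extend beyond the zeroth coordinate.\<close>

section \<open>Membership in the extension as a condition on consecutive coordinates\<close>

text \<open>The defining recursion splits off the last application of \<open>f\<close>. Splitting
  off the first one instead fits chains with \<open>f (x (Suc n)) = x n\<close>, where the domain
  condition at \<open>Suc n\<close> has to be compared with the one at \<open>n\<close>.\<close>

lemma iterate_domain_Suc_iff:
  assumes "D \<subseteq> topspace X" and "f \<in> D \<rightarrow> topspace X"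
  shows "b \<in> iterate_domain X D f (Suc n) \<longleftrightarrow> b \<in> D \<and> f b \<in> iterate_domain X D f n"
proof (induction n)
  case 0
  show ?case using assms by auto
next
  case (Suc n)
  have "b \<in> iterate_domain X D f (Suc (Suc n)) \<longleftrightarrow>
      b \<in> iterate_domain X D f (Suc n) \<and> (f ^^ Suc n) b \<in> D"
    by simp
  also have "\<dots> \<longleftrightarrow> (b \<in> D \<and> f b \<in> iterate_domain X D f n) \<and> (f ^^ n) (f b) \<in> D"
    by (simp only: Suc.IH funpow_Suc_right comp_apply)
  finally show ?case by auto
qed

text \<open>Neither an index nor an iterate domain occurs here, so the condition survives shifting a
  sequence. The iterate domains are recovered from the whole chain of links.\<close>

definition ext_link :: "'a set \<Rightarrow> ('a \<Rightarrow> 'a) \<Rightarrow> 'a option \<Rightarrow> 'a option \<Rightarrow> bool" where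
  "ext_link D f u v \<longleftrightarrow>
     (case u of None \<Rightarrow> v = None
      | Some a \<Rightarrow> (case v of None \<Rightarrow> a \<notin> f ` D | Some b \<Rightarrow> b \<in> D \<and> f b = a))"

lemma ext_link_simps [simp]:
  "ext_link D f None v \<longleftrightarrow> v = None"
  "ext_link D f (Some a) None \<longleftrightarrow> a \<notin> f ` D"
  "ext_link D f (Some a) (Some b) \<longleftrightarrow> b \<in> D \<and> f b = a"
  by (simp_all add: ext_link_def)

lemma iterate_domain_subset_topspace: "iterate_domain X D f n \<subseteq> topspace X"
  by (induction n) auto

lemma topspace_extension:
  "topspace (extension X D f) = (\<Union>N. ext_finite X D f N) \<union> ext_infinite X D f"
proof -
  have "x n \<in> topspace X" if "x n \<in> iterate_domain X D f n" for x n
    using that by (rule iterate_domain_subset_topspace [THEN subsetD])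
  then have "(\<Union>N. ext_finite X D f N) \<union> ext_infinite X D f
      \<subseteq> topspace (product_topology (\<lambda>_. adjoin_isolated X) UNIV)"
    by (fastforce simp: ext_finite_def ext_infinite_def topspace_adjoin_isolated)
  then show ?thesis
    unfolding extension_def topspace_subtopology by (rule Int_absorb1)
qed

text \<open>By \<open>iterate_domain_Suc_iff\<close>, a link between two points is what carries the
  domain condition from one index to the next. For the converse, whether \<open>None\<close> occurs
  decides between \<open>ext_finite\<close> and \<open>ext_infinite\<close>.\<close>

lemma mem_extension_iff:
  assumes D: "D \<subseteq> topspace X" and f: "f \<in> D \<rightarrow> topspace X"
  shows "y \<in> topspace (extension X D f) \<longleftrightarrow>
      y 0 \<in> Some ` topspace X \<and> (\<forall>n. ext_link D f (y n) (y (Suc n)))"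
    (is "_ \<longleftrightarrow> ?zeroth \<and> ?linked")
proof
  assume "y \<in> topspace (extension X D f)"
  then consider N x where "y = (\<lambda>n. if n \<le> N then Some (x n) else None)"
      "\<forall>n\<le>N. x n \<in> iterate_domain X D f n" "x N \<notin> f ` D"
      "\<forall>n. 1 \<le> n \<and> n \<le> N \<longrightarrow> f (x n) = x (n - 1)"
    | x where "y = (\<lambda>n. Some (x n))" "\<forall>n. x n \<in> iterate_domain X D f n"
      "\<forall>n\<ge>1. f (x n) = x (n - 1)"
    by (auto simp: topspace_extension ext_finite_def ext_infinite_def)
  then show "?zeroth \<and> ?linked"
  proof cases
    case 1
    have "ext_link D f (y n) (y (Suc n))" for n
    proof (cases "Suc n \<le> N")
      case True
      then have "x (Suc n) \<in> D" "f (x (Suc n)) = x n"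
        using 1 iterate_domain_Suc_iff [OF D f] by (blast, force)
      with True show ?thesis by (simp add: 1(1))
    next
      case False
      then show ?thesis using 1(3) by (cases "n = N") (auto simp: 1(1))
    qed
    moreover have "x 0 \<in> topspace X" using 1(2) by force
    ultimately show ?thesis by (simp add: 1(1))
  next
    case 2
    have "x (Suc n) \<in> D \<and> f (x (Suc n)) = x n" for n
      using 2 iterate_domain_Suc_iff [OF D f] by (metis diff_Suc_1 le_add1 plus_1_eq_Suc)
    moreover have "x 0 \<in> topspace X" using 2(2) by (metis iterate_domain.simps(1))
    ultimately show ?thesis by (simp add: 2(1))
  qed
next
  assume y: "?zeroth \<and> ?linked"
  then obtain x0 where x0: "y 0 = Some x0" "x0 \<in> topspace X" by blast
  define x where "x = (\<lambda>n. the (y n))"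
  \<comment> \<open>Since \<open>None\<close> links only to \<open>None\<close>, a point at
    \<open>Suc n\<close> forces a point at \<open>n\<close>.\<close>
  have step: "y n = Some (x n) \<and> x (Suc n) \<in> D \<and> f (x (Suc n)) = x n"
    if "y (Suc n) \<noteq> None" for n
    using that y [THEN conjunct2, rule_format, of n]
    by (cases "y n"; cases "y (Suc n)") (auto simp: x_def)
  have dom: "x n \<in> iterate_domain X D f n" if "y n \<noteq> None" for n
    using that
  proof (induction n)
    case 0
    then show ?case using x0 by (simp add: x_def)
  next
    case (Suc n)
    then show ?case using step [of n] iterate_domain_Suc_iff [OF D f] by auto
  qed
  have rec: "f (x n) = x (n - 1)" if "1 \<le> n" "y n \<noteq> None" for n
    using that step [of "n - 1"] by simp
  show "y \<in> topspace (extension X D f)"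
  proof (cases "\<forall>n. y n \<noteq> None")
    case True
    then have "y = (\<lambda>n. Some (x n))" by (auto simp: x_def)
    with True dom rec have "y \<in> ext_infinite X D f"
      unfolding ext_infinite_def by blast
    then show ?thesis by (simp add: topspace_extension)
  next
    case False
    \<comment> \<open>The first \<open>None\<close> is not at index 0, so its predecessor
      \<open>N\<close> is the index of the last point; the link from \<open>N\<close> to
      \<open>M\<close> then gives the stopping condition.\<close>
    define M where "M = (LEAST n. y n = None)"
    have M: "y M = None" using False by (auto simp: M_def intro: LeastI)
    with x0 obtain N where N: "M = Suc N" by (cases M) auto
    have some: "y n \<noteq> None" if "n \<le> N" for n
      using that not_less_Least [of n "\<lambda>n. y n = None"] N M_def by auto
    have none: "y n = None" if "M \<le> n" for n
      using that
    proof (induction n rule: dec_induct)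
      case (step n)
      then show ?case using y by (metis ext_link_simps(1))
    qed (rule M)
    have eq: "y = (\<lambda>n. if n \<le> N then Some (x n) else None)"
      using some none N by (auto simp: x_def fun_eq_iff not_less_eq_eq)
    have "ext_link D f (y N) (y M)" using y N by simp
    then have "x N \<notin> f ` D" using M by (simp add: eq)
    with eq some dom rec have "y \<in> ext_finite X D f N"
      unfolding ext_finite_def by blast
    then show ?thesis by (auto simp: topspace_extension)
  qed
qed

section \<open>Continuity of maps into and out of the extension\<close>

lemma continuous_map_Some: "continuous_map X (adjoin_isolated X) Some"
  by (auto simp: continuous_map openin_adjoin_isolated topspace_adjoin_isolated
      intro: openin_subset [THEN subsetD] elim!: back_subst [where P = "openin X"])

lemma continuous_map_coordinate:
  "continuous_map (extension X D f) (adjoin_isolated X) (\<lambda>x. x n)"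
  unfolding extension_def
  by (intro continuous_map_from_subtopology continuous_map_product_projection) simp

text \<open>The universal property of a subspace of a product; it serves both \<open>ext_map\<close>
  and the left shift.\<close>

lemma continuous_map_into_extension:
  assumes "\<And>n. continuous_map Z (adjoin_isolated X) (\<lambda>z. g z n)"
    and "g \<in> topspace Z \<rightarrow> topspace (extension X D f)"
  shows "continuous_map Z (extension X D f) g"
  using assms
  by (auto simp: extension_def continuous_map_in_subtopology continuous_map_componentwise_UNIV)

lemma continuous_map_ext_proj:
  assumes "D \<subseteq> topspace X" and "f \<in> D \<rightarrow> topspace X"
  shows "continuous_map (extension X D f) X ext_proj"
  unfolding continuous_map
proof (intro conjI allI impI)
  show "ext_proj ` topspace (extension X D f) \<subseteq> topspace X"
    by (auto simp: mem_extension_iff [OF assms] ext_proj_def)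
next
  fix U assume U: "openin X U"
  then have "openin (adjoin_isolated X) (Some ` U)"
    using openin_subset by (auto simp: openin_adjoin_isolated image_iff)
  then have "openin (extension X D f)
      {x \<in> topspace (extension X D f). x 0 \<in> Some ` U}"
    using continuous_map_coordinate by (rule openin_continuous_map_preimage [rotated])
  moreover have "x 0 \<in> Some ` U \<longleftrightarrow> ext_proj x \<in> U" if "x \<in> topspace (extension X D f)" for x
    using that by (auto simp: mem_extension_iff [OF assms] ext_proj_def)
  ultimately show "openin (extension X D f)
      {x \<in> topspace (extension X D f). ext_proj x \<in> U}"
    by (simp cong: conj_cong)
qed

lemma ext_map_simps [simp]:
  "ext_map f x 0 = Some (f (ext_proj x))"
  "ext_map f x (Suc n) = x n"
  by (simp_all add: ext_map_def)

lemma ext_proj_ext_map [simp]: "ext_proj (ext_map f x) = f (ext_proj x)"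
  by (simp add: ext_proj_def)

lemma topspace_ext_preimage [simp]:
  "topspace (subtopology (extension X D f) (ext_preimage X D f A)) = ext_preimage X D f A"
  by (auto simp: ext_preimage_def)

section \<open>The lifted map and its inverse, the left shift\<close>

context
  fixes X :: "'a topology" and D :: "'a set" and f :: "'a \<Rightarrow> 'a"
  assumes D: "D \<subseteq> topspace X" and f: "continuous_map (subtopology X D) X f"
begin

lemma map_in_topspace: "f \<in> D \<rightarrow> topspace X"
  using D continuous_map_image_subset_topspace [OF f] by auto

lemma mem_ext_preimage_iff:
  "x \<in> ext_preimage X D f A \<longleftrightarrow>
     (\<exists>a \<in> A \<inter> topspace X. x 0 = Some a) \<and> (\<forall>n. ext_link D f (x n) (x (Suc n)))"
  by (auto simp: ext_preimage_def mem_extension_iff [OF D map_in_topspace] ext_proj_def)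

text \<open>Prefixing moves the old links up by one index and adds a single new link, from
  \<open>f a\<close> to \<open>a\<close>, which holds because \<open>a \<in> D\<close>.\<close>

lemma ext_map_mem:
  assumes x: "x \<in> ext_preimage X D f D"
  shows "ext_map f x \<in> ext_preimage X D f (f ` D)"
proof -
  obtain a where a: "a \<in> D" "x 0 = Some a"
    and link: "\<And>n. ext_link D f (x n) (x (Suc n))"
    using x by (auto simp: mem_ext_preimage_iff)
  have "ext_link D f (ext_map f x n) (ext_map f x (Suc n))" for n
    using a link by (cases n) (auto simp: ext_proj_def)
  with a map_in_topspace show ?thesis
    by (auto simp: mem_ext_preimage_iff ext_proj_def)
qed

lemma shift_mem:
  assumes y: "y \<in> ext_preimage X D f (f ` D)"
  shows "(\<lambda>n. y (Suc n)) \<in> ext_preimage X D f D" and "ext_map f (\<lambda>n. y (Suc n)) = y"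
proof -
  obtain a where a: "a \<in> f ` D" "y 0 = Some a"
    and link: "\<And>n. ext_link D f (y n) (y (Suc n))"
    using y by (auto simp: mem_ext_preimage_iff)
  obtain b where b: "y (Suc 0) = Some b" "b \<in> D" "f b = a"
    using link [of 0] a by (cases "y (Suc 0)") auto
  show "(\<lambda>n. y (Suc n)) \<in> ext_preimage X D f D"
    using b D link by (auto simp: mem_ext_preimage_iff)
  show "ext_map f (\<lambda>n. y (Suc n)) = y"
  proof
    show "ext_map f (\<lambda>n. y (Suc n)) n = y n" for n
      using a b by (cases n) (auto simp: ext_proj_def)
  qed
qed

lemma continuous_map_ext_map:
  "continuous_map (subtopology (extension X D f) (ext_preimage X D f D)) (extension X D f)
     (ext_map f)"
proof (rule continuous_map_into_extension)
  let ?S = "subtopology (extension X D f) (ext_preimage X D f D)"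
  \<comment> \<open>As \<open>f\<close> is continuous only on \<open>D\<close>, the projection needs
    the subspace \<open>D\<close> as its codomain before \<open>f\<close> can be composed with
    it.\<close>
  have "continuous_map ?S (subtopology X D) ext_proj"
    using continuous_map_ext_proj [OF D map_in_topspace]
    by (auto simp: continuous_map_in_subtopology ext_preimage_def
        intro: continuous_map_from_subtopology)
  from continuous_map_compose [OF this continuous_map_compose [OF f continuous_map_Some]]
  have "continuous_map ?S (adjoin_isolated X) (\<lambda>x. Some (f (ext_proj x)))"
    by (simp add: o_def)
  then show "continuous_map ?S (adjoin_isolated X) (\<lambda>x. ext_map f x n)" for n
    by (cases n) (simp_all add: continuous_map_coordinate continuous_map_from_subtopology)
  show "ext_map f \<in> topspace ?S \<rightarrow> topspace (extension X D f)"
    using ext_map_mem by (auto simp: ext_preimage_def)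
qed

lemma homeomorphic_map_ext_map:
  "homeomorphic_map
     (subtopology (extension X D f) (ext_preimage X D f D))
     (subtopology (extension X D f) (ext_preimage X D f (f ` D)))
     (ext_map f)"
proof -
  let ?S = "subtopology (extension X D f) (ext_preimage X D f (f ` D))"
  have "continuous_map ?S (extension X D f) (\<lambda>y n. y (Suc n))"
  proof (rule continuous_map_into_extension)
    show "continuous_map ?S (adjoin_isolated X) (\<lambda>y. y (Suc n))" for n
      by (intro continuous_map_from_subtopology continuous_map_coordinate)
    show "(\<lambda>y n. y (Suc n)) \<in> topspace ?S \<rightarrow> topspace (extension X D f)"
      using shift_mem(1) by (auto simp: ext_preimage_def)
  qed
  \<comment> \<open>Shifting after \<open>ext_map\<close> is the identity by
    \<open>ext_map_simps\<close>; the other composite is \<open>shift_mem(2)\<close>.\<close>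
  then have "homeomorphic_maps
     (subtopology (extension X D f) (ext_preimage X D f D)) ?S
     (ext_map f) (\<lambda>y n. y (Suc n))"
    using continuous_map_ext_map ext_map_mem shift_mem
    by (simp add: homeomorphic_maps_def continuous_map_in_subtopology image_subset_iff)
  then show ?thesis by (rule homeomorphic_maps_imp_map)
qed

text \<open>The topological conditions on the domain and the image are pulled back from
  \<open>X\<close> along the continuous \<open>ext_proj\<close>; the image is known from
  surjectivity of the homeomorphism.\<close>

lemma partial_homeomorphism_ext_map:
  assumes "openin X D" and "closedin X D" and "openin X (f ` D)"
  shows "partial_homeomorphism (extension X D f) (ext_preimage X D f D) (ext_map f)"
proof -
  note proj = continuous_map_ext_proj [OF D map_in_topspace]
  have "ext_map f ` ext_preimage X D f D = ext_preimage X D f (f ` D)"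
    using homeomorphic_imp_surjective_map [OF homeomorphic_map_ext_map]
    by (simp only: topspace_ext_preimage)
  moreover have "openin (extension X D f) (ext_preimage X D f A)" if "openin X A" for A
    unfolding ext_preimage_def using proj that by (rule openin_continuous_map_preimage)
  moreover have "closedin (extension X D f) (ext_preimage X D f D)"
    unfolding ext_preimage_def using proj assms(2) by (rule closedin_continuous_map_preimage)
  moreover have "inj_on (ext_map f) (ext_preimage X D f D)"
    using homeomorphic_imp_injective_map [OF homeomorphic_map_ext_map]
    by (simp only: topspace_ext_preimage)
  ultimately show ?thesis
    using assms continuous_map_ext_map
    by (simp add: partial_homeomorphism_def partial_mapping_def)
qed

end

theorem proposition2p5:
  fixes X :: "'a topology" and \<Delta>1 :: "'a set" and \<alpha> :: "'a \<Rightarrow> 'a"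
  assumes "compact_space X" and "Hausdorff_space X"
    and "openin X \<Delta>1" and "closedin X \<Delta>1"
    and "continuous_map (subtopology X \<Delta>1) X \<alpha>"
  shows "homeomorphic_map
           (subtopology (extension X \<Delta>1 \<alpha>) (ext_preimage X \<Delta>1 \<alpha> \<Delta>1))
           (subtopology (extension X \<Delta>1 \<alpha>) (ext_preimage X \<Delta>1 \<alpha> (\<alpha> ` \<Delta>1)))
           (ext_map \<alpha>) \<and>
         (openin X (\<alpha> ` \<Delta>1) \<longrightarrow>
           partial_homeomorphism (extension X \<Delta>1 \<alpha>) (ext_preimage X \<Delta>1 \<alpha> \<Delta>1) (ext_map \<alpha>)) \<and>
         (\<forall>x \<in> ext_preimage X \<Delta>1 \<alpha> \<Delta>1. ext_proj (ext_map \<alpha> x) = \<alpha> (ext_proj x))"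
  \<comment> \<open>The intertwining relation is the simplification rule
    \<open>ext_proj_ext_map\<close>.\<close>
  using homeomorphic_map_ext_map [OF openin_subset [OF assms(3)] assms(5)]
    partial_homeomorphism_ext_map [OF openin_subset [OF assms(3)] assms(5,3,4)]
  by simp

end
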